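(* Let $\Delta$ be a twin building of type $(W,S)$, let $J\subseteq S$ be nonempty, and let $\theta$ be an automorphism of $\Delta$ that is $J$-opposite. Then $\theta$ is $\{s\}$-opposite for every $s\in J$.
   Context: $(W,S)$ is a Coxeter system with $S$ finite and $W$ irreducible. A twin building consists of two buildings $\Delta^+,\Delta^-$ of type $(W,S)$ with a codistance $\delta^*$ satisfying the usual twin building axioms. A $K$-residue of $\Delta^\epsilon$ is a set $\{D\in\Delta^\epsilon:\delta(C,D)\in W_K\}$. Chambers in different halves are opposite if $\delta^*(C,D)=1$; residues $P,Q$ in different halves are opposite if every chamber of $P$ is opposite some chamber of $Q$. An automorphism is a bijection of chambers preserving adjacency and opposition (not necessarily type preserving). For $J\subseteq S$, $\theta$ is called $J$-opposite if it maps every $S\setminus J$-residue to an opposite residue. *)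

theory Defs
  imports "HOL-Algebra.Generated_Groups" "HOL-Algebra.Multiplicative_Group"
begin

section \<open>Coxeter systems\<close>

definition word_prod :: "('w, 'b) monoid_scheme \<Rightarrow> 'w list \<Rightarrow> 'w" where
  "word_prod W ws = foldr (mult W) ws \<one>\<^bsub>W\<^esub>"

text \<open>
  The congruence on words over \<open>S\<close> generated by the relators \<open>(s t)^m(s,t)\<close>, where \<open>m(s,t)\<close> is
  the order of \<open>s t\<close>. The library's \<open>ord\<close> is \<open>0\<close> on elements of infinite order, for which the
  relator is the empty word. For \<open>s = t\<close> (an involution) the order is \<open>1\<close> and the relator is
  \<open>s s\<close>; hence generators are their own inverses modulo the congruence, and words without formal
  inverses suffice to describe the group with this presentation.
\<close>

inductive coxeter_cong :: "('w, 'b) monoid_scheme \<Rightarrow> 'w set \<Rightarrow> 'w list \<Rightarrow> 'w list \<Rightarrow> bool"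
  for W S where
  refl: "u \<in> lists S \<Longrightarrow> coxeter_cong W S u u"
| sym: "coxeter_cong W S u v \<Longrightarrow> coxeter_cong W S v u"
| trans: "coxeter_cong W S u v \<Longrightarrow> coxeter_cong W S v w \<Longrightarrow> coxeter_cong W S u w"
| relator: "u \<in> lists S \<Longrightarrow> v \<in> lists S \<Longrightarrow> s \<in> S \<Longrightarrow> t \<in> S \<Longrightarrow>
    coxeter_cong W S (u @ concat (replicate (group.ord W (s \<otimes>\<^bsub>W\<^esub> t)) [s, t]) @ v) (u @ v)"

text \<open>
  \<open>(W,S)\<close> is a Coxeter system if \<open>S\<close> is a generating set of elements of order 2 and
  \<open>W = \<langle>S | (s t)^m(s,t) = 1\<rangle>\<close>.
\<close>

locale coxeter_system = group W for W (structure) +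
  fixes S :: "'a set"
  assumes S_carrier: "S \<subseteq> carrier W"
    and S_order: "s \<in> S \<Longrightarrow> ord s = 2"
    and S_generates: "generate W S = carrier W"
    and presentation: "u \<in> lists S \<Longrightarrow> v \<in> lists S \<Longrightarrow>
      word_prod W u = word_prod W v \<longleftrightarrow> coxeter_cong W S u v"

definition coxeter_length :: "('w, 'b) monoid_scheme \<Rightarrow> 'w set \<Rightarrow> 'w \<Rightarrow> nat" where
  "coxeter_length W S w = (LEAST n. \<exists>ws \<in> lists S. length ws = n \<and> word_prod W ws = w)"

text \<open>Connectedness of the Coxeter diagram, whose edges are the pairs with \<open>m(s,t) \<ge> 3\<close>.\<close>

definition coxeter_irreducible :: "('w, 'b) monoid_scheme \<Rightarrow> 'w set \<Rightarrow> bool" where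
  "coxeter_irreducible W S \<longleftrightarrow> S \<noteq> {} \<and>
     (\<forall>I \<subseteq> S. (\<forall>s \<in> I. \<forall>t \<in> S - I. group.ord W (s \<otimes>\<^bsub>W\<^esub> t) = 2) \<longrightarrow> I = {} \<or> I = S)"


section \<open>Buildings and twin buildings\<close>

locale building = coxeter_system W S for W (structure) and S +
  fixes C :: "'c set" and \<delta> :: "'c \<Rightarrow> 'c \<Rightarrow> 'a"
  assumes nonempty: "C \<noteq> {}"
    and dist_carrier: "x \<in> C \<Longrightarrow> y \<in> C \<Longrightarrow> \<delta> x y \<in> carrier W"
    and dist_one_iff: "x \<in> C \<Longrightarrow> y \<in> C \<Longrightarrow> \<delta> x y = \<one> \<longleftrightarrow> x = y"
    and dist_step: "x \<in> C \<Longrightarrow> y \<in> C \<Longrightarrow> x' \<in> C \<Longrightarrow> s \<in> S \<Longrightarrow> \<delta> x' x = s \<Longrightarrow>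
      \<delta> x' y = s \<otimes> \<delta> x y \<or> \<delta> x' y = \<delta> x y"
    and dist_step_up: "x \<in> C \<Longrightarrow> y \<in> C \<Longrightarrow> x' \<in> C \<Longrightarrow> s \<in> S \<Longrightarrow> \<delta> x' x = s \<Longrightarrow>
      coxeter_length W S (s \<otimes> \<delta> x y) = coxeter_length W S (\<delta> x y) + 1 \<Longrightarrow>
      \<delta> x' y = s \<otimes> \<delta> x y"
    and dist_ex: "x \<in> C \<Longrightarrow> y \<in> C \<Longrightarrow> s \<in> S \<Longrightarrow>
      \<exists>x' \<in> C. \<delta> x' x = s \<and> \<delta> x' y = s \<otimes> \<delta> x y"

datatype sign = Plus | Minus

text \<open>The two halves, as disjoint sets of chambers, with their Weyl distances and the codistance.\<close>

record ('c, 'w) twin =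
  half :: "sign \<Rightarrow> 'c set"
  dist :: "sign \<Rightarrow> 'c \<Rightarrow> 'c \<Rightarrow> 'w"
  codist :: "'c \<Rightarrow> 'c \<Rightarrow> 'w"

locale twin_building = coxeter_system W S for W (structure) and S +
  fixes \<Delta> :: "('c, 'a) twin"
  assumes halves_disjoint: "half \<Delta> Plus \<inter> half \<Delta> Minus = {}"
    and half_building: "building W S (half \<Delta> \<epsilon>) (dist \<Delta> \<epsilon>)"
    and codist_carrier: "\<epsilon> \<noteq> \<epsilon>' \<Longrightarrow> x \<in> half \<Delta> \<epsilon> \<Longrightarrow> y \<in> half \<Delta> \<epsilon>' \<Longrightarrow> codist \<Delta> x y \<in> carrier W"
    and codist_inv: "\<epsilon> \<noteq> \<epsilon>' \<Longrightarrow> x \<in> half \<Delta> \<epsilon> \<Longrightarrow> y \<in> half \<Delta> \<epsilon>' \<Longrightarrow>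
      codist \<Delta> x y = inv (codist \<Delta> y x)"
    and codist_step_down: "\<epsilon> \<noteq> \<epsilon>' \<Longrightarrow> x \<in> half \<Delta> \<epsilon> \<Longrightarrow> y \<in> half \<Delta> \<epsilon>' \<Longrightarrow>
      x' \<in> half \<Delta> \<epsilon> \<Longrightarrow> s \<in> S \<Longrightarrow> dist \<Delta> \<epsilon> x' x = s \<Longrightarrow>
      coxeter_length W S (s \<otimes> codist \<Delta> x y) < coxeter_length W S (codist \<Delta> x y) \<Longrightarrow>
      codist \<Delta> x' y = s \<otimes> codist \<Delta> x y"
    and codist_ex: "\<epsilon> \<noteq> \<epsilon>' \<Longrightarrow> x \<in> half \<Delta> \<epsilon> \<Longrightarrow> y \<in> half \<Delta> \<epsilon>' \<Longrightarrow> s \<in> S \<Longrightarrow>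
      \<exists>x' \<in> half \<Delta> \<epsilon>. dist \<Delta> \<epsilon> x' x = s \<and> codist \<Delta> x' y = s \<otimes> codist \<Delta> x y"

definition chambers :: "('c, 'w) twin \<Rightarrow> 'c set" where
  "chambers \<Delta> = half \<Delta> Plus \<union> half \<Delta> Minus"

definition adjacent :: "'w set \<Rightarrow> ('c, 'w) twin \<Rightarrow> 'c \<Rightarrow> 'c \<Rightarrow> bool" where
  "adjacent S \<Delta> x y \<longleftrightarrow> (\<exists>\<epsilon>. x \<in> half \<Delta> \<epsilon> \<and> y \<in> half \<Delta> \<epsilon> \<and> dist \<Delta> \<epsilon> x y \<in> S)"

definition opposite :: "('w, 'b) monoid_scheme \<Rightarrow> ('c, 'w) twin \<Rightarrow> 'c \<Rightarrow> 'c \<Rightarrow> bool" where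
  "opposite W \<Delta> x y \<longleftrightarrow>
     (\<exists>\<epsilon> \<epsilon>'. \<epsilon> \<noteq> \<epsilon>' \<and> x \<in> half \<Delta> \<epsilon> \<and> y \<in> half \<Delta> \<epsilon>' \<and> codist \<Delta> x y = \<one>\<^bsub>W\<^esub>)"

definition is_residue ::
    "('w, 'b) monoid_scheme \<Rightarrow> ('c, 'w) twin \<Rightarrow> sign \<Rightarrow> 'w set \<Rightarrow> 'c set \<Rightarrow> bool" where
  "is_residue W \<Delta> \<epsilon> K R \<longleftrightarrow>
     (\<exists>x \<in> half \<Delta> \<epsilon>. R = {y \<in> half \<Delta> \<epsilon>. dist \<Delta> \<epsilon> x y \<in> generate W K})"

text \<open>The types of the two residues are not required to agree.\<close>

definition opposite_residues ::
    "('w, 'b) monoid_scheme \<Rightarrow> 'w set \<Rightarrow> ('c, 'w) twin \<Rightarrow> 'c set \<Rightarrow> 'c set \<Rightarrow> bool" where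
  "opposite_residues W S \<Delta> P Q \<longleftrightarrow>
     (\<exists>\<epsilon> \<epsilon>' K L. \<epsilon> \<noteq> \<epsilon>' \<and> K \<subseteq> S \<and> L \<subseteq> S \<and> is_residue W \<Delta> \<epsilon> K P \<and> is_residue W \<Delta> \<epsilon>' L Q) \<and>
     (\<forall>x \<in> P. \<exists>y \<in> Q. opposite W \<Delta> x y)"

text \<open>Automorphisms may permute types and may interchange the two halves.\<close>

definition twin_automorphism ::
    "('w, 'b) monoid_scheme \<Rightarrow> 'w set \<Rightarrow> ('c, 'w) twin \<Rightarrow> ('c \<Rightarrow> 'c) \<Rightarrow> bool" where
  "twin_automorphism W S \<Delta> \<theta> \<longleftrightarrow>
     bij_betw \<theta> (chambers \<Delta>) (chambers \<Delta>) \<and>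
     (\<forall>x \<in> chambers \<Delta>. \<forall>y \<in> chambers \<Delta>. adjacent S \<Delta> (\<theta> x) (\<theta> y) \<longleftrightarrow> adjacent S \<Delta> x y) \<and>
     (\<forall>x \<in> chambers \<Delta>. \<forall>y \<in> chambers \<Delta>. opposite W \<Delta> (\<theta> x) (\<theta> y) \<longleftrightarrow> opposite W \<Delta> x y)"

definition J_opposite ::
    "('w, 'b) monoid_scheme \<Rightarrow> 'w set \<Rightarrow> ('c, 'w) twin \<Rightarrow> 'w set \<Rightarrow> ('c \<Rightarrow> 'c) \<Rightarrow> bool" where
  "J_opposite W S \<Delta> J \<theta> \<longleftrightarrow>
     (\<forall>\<epsilon> R. is_residue W \<Delta> \<epsilon> (S - J) R \<longrightarrow> opposite_residues W S \<Delta> R (\<theta> ` R))"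

end

theory Submission
  imports Defs
begin

text \<open>
  Every chamber \<open>x\<close> of a residue \<open>R\<close> of type \<open>S - {s}\<close> lies in a residue of type \<open>S - J\<close> inside \<open>R\<close>,
  so \<open>x\<close> is opposite some chamber of \<open>\<theta> ` R\<close>. What needs proof is that \<open>\<theta> ` R\<close> is again a residue:
  an automorphism of the chamber graph need not induce a permutation of the types (for a free
  product of involutions the thin chamber graph is a tree). Opposition forces
  \<open>codist x (\<theta> x)\<close> to lie in the parabolic subgroup of \<open>S - J\<close> for all \<open>x\<close>. Comparing
  adjacent chambers, it follows that \<open>\<theta>\<close> maps \<open>s\<close>-panels to \<open>s\<close>-panels for each \<open>s \<in> J\<close>. The only input
  on Coxeter groups, besides the parity of the length, is that a standard parabolic subgroup contains
  no generators other than its own.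
\<close>

section \<open>Parabolic subgroups of Coxeter systems\<close>

text \<open>For \<open>ws = [s\<^sub>1, \<dots>, s\<^sub>n]\<close>, the list of the reflections \<open>s\<^sub>1 \<cdots> s\<^sub>i \<cdots> s\<^sub>1\<close>.\<close>

fun reflection_list :: "('w, 'b) monoid_scheme \<Rightarrow> 'w list \<Rightarrow> 'w list" where
  "reflection_list W [] = []"
| "reflection_list W (a # ws) = a # map (\<lambda>r. a \<otimes>\<^bsub>W\<^esub> r \<otimes>\<^bsub>W\<^esub> a) (reflection_list W ws)"

lemma word_prod_Nil [simp]: "word_prod W [] = \<one>\<^bsub>W\<^esub>"
  by (simp add: word_prod_def)

lemma word_prod_Cons [simp]: "word_prod W (a # ws) = a \<otimes>\<^bsub>W\<^esub> word_prod W ws"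
  by (simp add: word_prod_def)

lemma length_reflection_list [simp]: "length (reflection_list W ws) = length ws"
  by (induction ws) auto

lemma count_list_distinct: "distinct xs \<Longrightarrow> count_list xs x = (if x \<in> set xs then 1 else 0)"
  by (induction xs) auto

context coxeter_system
begin

section \<open>Generators and products of words\<close>

lemma gen_closed: "s \<in> S \<Longrightarrow> s \<in> carrier W"
  using S_carrier by auto

lemma gen_square: "s \<in> S \<Longrightarrow> s \<otimes> s = \<one>"
  using pow_ord_eq_1[of s] S_order[of s] gen_closed[of s] by (simp add: numeral_2_eq_2)

lemma gen_ne_one: "s \<in> S \<Longrightarrow> s \<noteq> \<one>"
  using S_order[of s] ord_eq_1[of \<one>] by auto

lemma gen_cancel: "s \<in> S \<Longrightarrow> w \<in> carrier W \<Longrightarrow> s \<otimes> (s \<otimes> w) = w"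
  by (metis gen_closed gen_square l_one m_assoc)

lemma gen_inv: "s \<in> S \<Longrightarrow> inv s = s"
  by (simp add: gen_closed gen_square inv_equality)

lemma word_prod_closed: "ws \<in> lists S \<Longrightarrow> word_prod W ws \<in> carrier W"
  by (induction ws) (auto simp: gen_closed)

lemma word_prod_append: "us \<in> lists S \<Longrightarrow> vs \<in> lists S \<Longrightarrow>
    word_prod W (us @ vs) = word_prod W us \<otimes> word_prod W vs"
  by (induction us) (auto simp: gen_closed word_prod_closed m_assoc)

section \<open>Reflections of a word and their parities\<close>

lemma reflection_list_closed: "ws \<in> lists S \<Longrightarrow> set (reflection_list W ws) \<subseteq> carrier W"
  by (induction ws) (auto simp: gen_closed)

text \<open>The reflection of a letter is its conjugate by the product of the letters before it, so
  prefixing \<open>us\<close> conjugates every reflection of \<open>vs\<close> by the product of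
  \<open>us\<close>.\<close>

lemma reflection_list_append:
  assumes "us \<in> lists S" "vs \<in> lists S"
  shows "reflection_list W (us @ vs) = reflection_list W us @
    map (\<lambda>r. word_prod W us \<otimes> r \<otimes> inv (word_prod W us)) (reflection_list W vs)"
  using assms(1)
proof (induction us rule: list.induct)
  case Nil
  have "map (\<lambda>r. \<one> \<otimes> r \<otimes> inv \<one>) (reflection_list W vs) = reflection_list W vs"
    using reflection_list_closed[OF assms(2)] by (intro map_idI) auto
  then show ?case by simp
next
  case (Cons a us)
  then have a: "a \<in> S" "a \<in> carrier W" and us: "us \<in> lists S"
    and p: "word_prod W us \<in> carrier W"
    by (auto simp: gen_closed word_prod_closed)
  have "a \<otimes> (word_prod W us \<otimes> r \<otimes> inv (word_prod W us)) \<otimes> a =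
      (a \<otimes> word_prod W us) \<otimes> r \<otimes> inv (a \<otimes> word_prod W us)" if "r \<in> carrier W" for r
    using a p that by (simp add: inv_mult_group gen_inv m_assoc)
  then show ?case
    using Cons.IH[OF us] reflection_list_closed[OF assms(2)] by auto
qed

lemma alternating_lists: "s \<in> S \<Longrightarrow> t \<in> S \<Longrightarrow> concat (replicate k [s, t]) \<in> lists S"
  by (induction k) auto

lemma word_prod_alternating:
  assumes "s \<in> S" "t \<in> S"
  shows "word_prod W (concat (replicate k [s, t])) = (s \<otimes> t) [^] k"
proof (induction k)
  case (Suc k)
  then show ?case
    using assms nat_pow_Suc2[of "s \<otimes> t" k] by (simp add: gen_closed m_assoc del: nat_pow_Suc)
qed simp

lemma reflection_list_alternating:
  assumes "s \<in> S" "t \<in> S"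
  shows "reflection_list W (concat (replicate k [s, t])) =
    map (\<lambda>i. (s \<otimes> t) [^] i \<otimes> s) [0..<2 * k]"
proof (induction k)
  case (Suc k)
  have c: "s \<in> carrier W" "t \<in> carrier W" using assms by (auto simp: gen_closed)
  \<comment> \<open>Prefixing \<open>[s, t]\<close> conjugates by \<open>s \<otimes> t\<close>,
    which raises the exponent by two; the two new letters supply the exponents 0 and 1.\<close>
  have shift: "s \<otimes> (t \<otimes> ((s \<otimes> t) [^] i \<otimes> s) \<otimes> t) \<otimes> s = (s \<otimes> t) [^] Suc (Suc i) \<otimes> s" for i :: nat
  proof -
    have "(s \<otimes> t) [^] Suc (Suc i) = (s \<otimes> t) \<otimes> ((s \<otimes> t) [^] i \<otimes> (s \<otimes> t))"
      using c by (metis m_closed nat_pow_Suc nat_pow_Suc2)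
    then show ?thesis using c by (simp add: m_assoc)
  qed
  have upt: "[0..<2 * Suc k] = 0 # 1 # map (\<lambda>i. Suc (Suc i)) [0..<2 * k]"
    by (rule nth_equalityI) (auto simp: nth_Cons split: nat.splits simp del: upt_Suc)
  show ?case unfolding upt using c
    by (simp add: Suc.IH shift o_def del: nat_pow_Suc upt_Suc)
qed simp

text \<open>The powers of \<open>s \<otimes> t\<close> have period
  \<open>ord (s \<otimes> t)\<close>, so the second half of the list repeats the first. For infinite
  order \<open>ord\<close> is 0, the relator is empty and so is \<open>rs\<close>.\<close>

lemma reflection_list_relator:
  assumes "s \<in> S" "t \<in> S"
  shows "\<exists>rs. reflection_list W (concat (replicate (ord (s \<otimes> t)) [s, t])) = rs @ rs"
proof -
  let ?m = "ord (s \<otimes> t)" and ?f = "\<lambda>i. (s \<otimes> t) [^] i \<otimes> s"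
  have st: "s \<otimes> t \<in> carrier W" using assms by (auto simp: gen_closed)
  have "[0..<2 * ?m] = [0..<?m] @ map (\<lambda>i. i + ?m) [0..<?m]"
    using upt_add_eq_append[of 0 ?m ?m] by (simp add: map_add_upt mult_2)
  moreover have "?f (i + ?m) = ?f i" for i
    using st pow_ord_eq_1[OF st] by (simp flip: nat_pow_mult)
  ultimately have "map ?f [0..<2 * ?m] = map ?f [0..<?m] @ map ?f [0..<?m]"
    by simp
  then show ?thesis using reflection_list_alternating[OF assms] by auto
qed

text \<open>Inserting a relator adds each reflection an even number of times. Since the relator has
  product one, it does not change the conjugation applied to the reflections after it.\<close>

lemma coxeter_cong_parity:
  assumes "coxeter_cong W S u v"
  shows "even (length u) = even (length v) \<and>
    (\<forall>r. even (count_list (reflection_list W u) r) = even (count_list (reflection_list W v) r))"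
  using assms
proof (induction rule: coxeter_cong.induct)
  case (relator u v s t)
  let ?w = "concat (replicate (ord (s \<otimes> t)) [s, t])"
  obtain rs where rs: "reflection_list W ?w = rs @ rs"
    using reflection_list_relator[OF relator(3,4)] by auto
  have w: "?w \<in> lists S" using alternating_lists[OF relator(3,4)] .
  have pw: "word_prod W ?w = \<one>"
    using relator(3,4) by (simp add: word_prod_alternating gen_closed pow_ord_eq_1)
  have id: "map (\<lambda>r. \<one> \<otimes> r \<otimes> inv \<one>) (reflection_list W v) = reflection_list W v"
    using reflection_list_closed[OF relator(2)] by (intro map_idI) auto
  have "even (length ?w)"
    by (metis length_reflection_list rs length_append even_add)
  moreover have "reflection_list W (?w @ v) = rs @ rs @ reflection_list W v"
    using reflection_list_append[OF w relator(2)] rs pw id by simp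
  then have "reflection_list W (u @ ?w @ v) = reflection_list W u @
      map (\<lambda>r. word_prod W u \<otimes> r \<otimes> inv (word_prod W u)) (rs @ rs @ reflection_list W v)"
    using reflection_list_append[of u "?w @ v"] relator w by simp
  ultimately show ?case
    using reflection_list_append[OF relator(1,2)] by auto
qed auto

lemma word_prod_eq_parity:
  assumes "u \<in> lists S" "v \<in> lists S" "word_prod W u = word_prod W v"
  shows "even (length u) = even (length v)"
    and "even (count_list (reflection_list W u) r) = even (count_list (reflection_list W v) r)"
  using coxeter_cong_parity presentation assms by auto

text \<open>Left multiplication by the reflection of a letter cancels that letter: conjugating by
  the letters in front moves the problem into the tail, until the reflection is the head itself. The
  remaining letters stay in \<open>K\<close>.\<close>

lemma reflection_deletes_letter:
  assumes "K \<subseteq> S" "ws \<in> lists K" "r \<in> set (reflection_list W ws)"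
  shows "\<exists>vs \<in> lists K. length vs < length ws \<and> word_prod W vs = r \<otimes> word_prod W ws"
  using assms(2,3)
proof (induction ws arbitrary: r rule: list.induct)
  case (Cons a ws)
  then have a: "a \<in> K" "a \<in> S" "a \<in> carrier W" and ws: "ws \<in> lists K" "ws \<in> lists S"
    using assms(1) by (auto simp: gen_closed)
  have p: "word_prod W ws \<in> carrier W" using ws word_prod_closed by auto
  show ?case
  proof (cases "r = a")
    case True
    then show ?thesis using ws a p by (intro bexI[of _ ws]) (auto simp: gen_cancel)
  next
    case False
    then obtain q where q: "q \<in> set (reflection_list W ws)" "r = a \<otimes> q \<otimes> a"
      using Cons.prems by auto
    have qc: "q \<in> carrier W" using q(1) reflection_list_closed[OF ws(2)] by auto
    obtain vs where vs: "vs \<in> lists K" "length vs < length ws"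
      "word_prod W vs = q \<otimes> word_prod W ws"
      using Cons.IH[OF ws(1) q(1)] by auto
    then show ?thesis using a p qc q(2)
      by (intro bexI[of _ "a # vs"]) (auto simp: m_assoc gen_cancel)
  qed
qed simp

lemma repeated_reflection_shortens:
  assumes "K \<subseteq> S" "ws \<in> lists K" "\<not> distinct (reflection_list W ws)"
  shows "\<exists>vs \<in> lists K. length vs < length ws \<and> word_prod W vs = word_prod W ws"
  using assms(2,3)
proof (induction ws rule: list.induct)
  case (Cons a ws)
  then have a: "a \<in> K" "a \<in> S" "a \<in> carrier W" and ws: "ws \<in> lists K" "ws \<in> lists S"
    using assms(1) by (auto simp: gen_closed)
  have conj_conj: "a \<otimes> (a \<otimes> r \<otimes> a) \<otimes> a = r" if "r \<in> carrier W" for r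
    using a that by (simp add: m_assoc gen_cancel gen_square)
  have inj: "inj_on (\<lambda>r. a \<otimes> r \<otimes> a) (set (reflection_list W ws))"
    using reflection_list_closed[OF ws(2)] conj_conj
    by (intro inj_on_inverseI[where g = "\<lambda>r. a \<otimes> r \<otimes> a"]) auto
  show ?case
  proof (cases "distinct (reflection_list W ws)")
    case True
    \<comment> \<open>Conjugation by \<open>a\<close> is injective, so the repetition involves the
      head. Hence \<open>a\<close> is itself a reflection of the tail, and multiplying the tail by
      \<open>a\<close> deletes one of its letters.\<close>
    then have "a \<in> (\<lambda>r. a \<otimes> r \<otimes> a) ` set (reflection_list W ws)"
      using Cons.prems(2) inj by (simp add: distinct_map)
    then obtain r where r: "r \<in> set (reflection_list W ws)" "a \<otimes> r \<otimes> a = a"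
      by (elim imageE) simp
    then have "r = a"
      using conj_conj[of r] a reflection_list_closed[OF ws(2)] by (auto simp: gen_square)
    then show ?thesis
      using reflection_deletes_letter[OF assms(1) ws(1) r(1)] less_SucI
      unfolding length_Cons word_prod_Cons by metis
  next
    case False
    then obtain vs where "vs \<in> lists K" "length vs < length ws" "word_prod W vs = word_prod W ws"
      using Cons.IH[OF ws(1)] by auto
    then show ?thesis using a by (intro bexI[of _ "a # vs"]) auto
  qed
qed simp

lemma generate_word:
  assumes "K \<subseteq> S" "w \<in> generate W K"
  shows "\<exists>ws \<in> lists K. word_prod W ws = w"
  using assms(2)
proof (induction rule: generate.induct)
  case one
  then show ?case by (intro bexI[of _ "[]"]) auto
next
  case (incl h)
  then show ?case using assms(1) by (intro bexI[of _ "[h]"]) (auto simp: gen_closed subset_iff)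
next
  case (inv h)
  then show ?case using assms(1)
    by (intro bexI[of _ "[h]"]) (auto simp: gen_closed gen_inv subset_iff)
next
  case (eng h1 h2)
  then obtain us vs where "us \<in> lists K" "vs \<in> lists K" "word_prod W us = h1" "word_prod W vs = h2"
    by auto
  then show ?case using assms(1) word_prod_append[of us vs] lists_mono[OF assms(1)]
    by (intro bexI[of _ "us @ vs"]) auto
qed

text \<open>A shortest word over \<open>K\<close> representing \<open>s\<close> has distinct reflections, and by parity these
  are exactly the reflections of the word \<open>[s]\<close>.\<close>

lemma gen_in_generate:
  assumes "K \<subseteq> S" "s \<in> S" "s \<in> generate W K"
  shows "s \<in> K"
proof -
  let ?P = "\<lambda>n. \<exists>ws \<in> lists K. length ws = n \<and> word_prod W ws = s"
  have "\<exists>n. ?P n" using generate_word[OF assms(1,3)] by auto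
  then have "?P (LEAST n. ?P n)" by (rule LeastI_ex)
  then obtain ws where ws: "ws \<in> lists K" "length ws = (LEAST n. ?P n)" "word_prod W ws = s"
    by auto
  have dist: "distinct (reflection_list W ws)"
    using repeated_reflection_shortens[OF assms(1) ws(1)] ws(2,3) not_less_Least[of _ ?P] by metis
  have eq: "word_prod W ws = word_prod W [s]"
    using ws(3) gen_closed[OF assms(2)] by simp
  have wsS: "ws \<in> lists S" using ws(1) lists_mono[OF assms(1)] by blast
  have "r \<in> set (reflection_list W ws) \<longleftrightarrow> r = s" for r
  proof -
    have "even (count_list (reflection_list W ws) r) = even (count_list [s] r)"
      using word_prod_eq_parity(2)[OF wsS _ eq] assms(2) by simp
    moreover have "count_list (reflection_list W ws) r =
        (if r \<in> set (reflection_list W ws) then 1 else 0)"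
      using dist by (rule count_list_distinct)
    ultimately show ?thesis by (auto split: if_splits)
  qed
  then have "set (reflection_list W ws) = {s}" by auto
  then have "length ws = 1"
    using distinct_card[OF dist] by simp
  then obtain k where k: "ws = [k]" by (auto simp: length_Suc_conv)
  then have "k = s" using ws(1,3) assms(1) gen_closed by auto
  then show ?thesis using ws(1) k by auto
qed

text \<open>Otherwise words of lengths 2 and 1 would represent the same element. This excludes
  triangles of mixed type in the chamber graph.\<close>

lemma gen_mult_gen_notin:
  assumes "s \<in> S" "t \<in> S"
  shows "s \<otimes> t \<notin> S"
proof
  assume "s \<otimes> t \<in> S"
  then show False
    using word_prod_eq_parity(1)[of "[s, t]" "[s \<otimes> t]"] assms by (auto simp: gen_closed)
qed

section \<open>Length under multiplication by a generator\<close>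

lemma coxeter_length_word:
  assumes "w \<in> carrier W"
  shows "\<exists>ws \<in> lists S. length ws = coxeter_length W S w \<and> word_prod W ws = w"
proof -
  have "\<exists>n. \<exists>ws \<in> lists S. length ws = n \<and> word_prod W ws = w"
    using generate_word[of S w] S_generates assms by auto
  then show ?thesis unfolding coxeter_length_def by (rule LeastI_ex)
qed

lemma coxeter_length_gen_mult:
  assumes "s \<in> S" "w \<in> carrier W"
  shows "coxeter_length W S (s \<otimes> w) \<noteq> coxeter_length W S w"
proof
  assume eq: "coxeter_length W S (s \<otimes> w) = coxeter_length W S w"
  obtain us where us: "us \<in> lists S" "length us = coxeter_length W S w" "word_prod W us = w"
    using coxeter_length_word[OF assms(2)] by auto
  obtain vs where vs: "vs \<in> lists S" "length vs = coxeter_length W S w" "word_prod W vs = s \<otimes> w"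
    using coxeter_length_word[of "s \<otimes> w"] assms eq by (auto simp: gen_closed)
  show False
    using word_prod_eq_parity(1)[of "s # us" vs] us vs assms by auto
qed

lemma generate_gen_mult:
  assumes "K \<subseteq> S" "k \<in> K" "w \<in> generate W K"
  shows "k \<otimes> w \<in> generate W K" "w \<otimes> k \<in> generate W K"
  using assms by (auto intro: generate.eng generate.incl)

end


section \<open>Galleries and residues\<close>

text \<open>Only membership of each step in \<open>K\<close> is recorded, not the word. Residues
  thus become connected components, which suits a map known only to preserve adjacency.\<close>

definition gallery :: "'c set \<Rightarrow> ('c \<Rightarrow> 'c \<Rightarrow> 'w) \<Rightarrow> 'w set \<Rightarrow> 'c \<Rightarrow> 'c \<Rightarrow> bool" where
  "gallery C \<delta> K = (\<lambda>x y. x \<in> C \<and> y \<in> C \<and> \<delta> x y \<in> K)\<^sup>*\<^sup>*"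

context building
begin

lemma dist_gen_sym:
  assumes "x \<in> C" "y \<in> C" "\<delta> x y \<in> S"
  shows "\<delta> y x = \<delta> x y"
proof -
  have "\<delta> x x = \<one>" using dist_one_iff[OF assms(1,1)] by simp
  moreover have "\<delta> y x \<noteq> \<one>"
    using dist_one_iff[OF assms(2,1)] dist_one_iff[OF assms(1,2)] gen_ne_one assms by metis
  \<comment> \<open>The step axiom, applied from \<open>y\<close> to \<open>x\<close> with target
    \<open>x\<close>, leaves this or \<open>\<delta> y x = \<one>\<close>.\<close>
  ultimately have "\<delta> x y \<otimes> \<delta> y x = \<one>"
    using dist_step[OF assms(2,1,1,3)] by auto
  then show ?thesis
    using assms dist_carrier gen_inv inv_unique' by (metis inv_equality inv_inv)
qed

lemma panel_trans:
  assumes "x \<in> C" "y \<in> C" "z \<in> C" "s \<in> S" "\<delta> x y = s" "\<delta> x z = s"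
  shows "y = z \<or> \<delta> y z = s"
proof -
  have "\<delta> y x = s" using dist_gen_sym assms by metis
  then have "\<delta> y z = s \<otimes> s \<or> \<delta> y z = s"
    using dist_step[OF assms(1,3,2,4)] assms by auto
  then show ?thesis using gen_square[OF assms(4)] dist_one_iff[OF assms(2,3)] by auto
qed

lemma triangle_types_eq:
  assumes "x \<in> C" "y \<in> C" "z \<in> C" "\<delta> x y \<in> S" "\<delta> x z \<in> S" "\<delta> y z \<in> S"
  shows "\<delta> x y = \<delta> x z"
proof -
  \<comment> \<open>The other value allowed by the step axiom,
    \<open>\<delta> a b \<otimes> \<delta> a c\<close>, is not a generator. Applying this with the
    last two chambers in either order compares all three sides.\<close>
  have *: "\<delta> b c = \<delta> a c"
    if "a \<in> C" "b \<in> C" "c \<in> C" "\<delta> a b \<in> S" "\<delta> a c \<in> S" "\<delta> b c \<in> S" for a b c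
    using dist_step[OF that(1,3,2,4)] dist_gen_sym[OF that(1,2,4)] gen_mult_gen_notin[OF that(4,5)] that(6)
    by metis
  show ?thesis
    using *[OF assms] *[of x z y] dist_gen_sym[OF assms(2,3,6)] assms by metis
qed

lemma gallery_carrier: "gallery C \<delta> K x y \<Longrightarrow> x \<in> C \<Longrightarrow> y \<in> C"
  unfolding gallery_def by (induction rule: rtranclp_induct) auto

lemma gallery_sym:
  assumes "K \<subseteq> S" "gallery C \<delta> K x y"
  shows "gallery C \<delta> K y x"
  using assms(2) unfolding gallery_def
proof (induction rule: rtranclp_induct)
  case (step y z)
  then have "z \<in> C \<and> y \<in> C \<and> \<delta> z y \<in> K"
    using dist_gen_sym[of y z] assms(1) by auto
  then show ?case using step.IH by (rule converse_rtranclp_into_rtranclp)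
qed auto

lemma gallery_trans: "gallery C \<delta> K x y \<Longrightarrow> gallery C \<delta> K y z \<Longrightarrow> gallery C \<delta> K x z"
  unfolding gallery_def by auto

lemma gallery_step: "x \<in> C \<Longrightarrow> y \<in> C \<Longrightarrow> \<delta> x y \<in> K \<Longrightarrow> gallery C \<delta> K x y"
  unfolding gallery_def by auto

lemma dist_generate_iff_gallery:
  assumes K: "K \<subseteq> S" and xy: "x \<in> C" "y \<in> C"
  shows "\<delta> x y \<in> generate W K \<longleftrightarrow> gallery C \<delta> K x y"
proof
  assume "gallery C \<delta> K x y"
  then show "\<delta> x y \<in> generate W K"
    unfolding gallery_def
  proof (induction rule: converse_rtranclp_induct)
    case base
    then show ?case using dist_one_iff[OF xy(2,2)] generate.one by metis
  next
    case (step x z)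
    then have "\<delta> x y = \<delta> x z \<otimes> \<delta> z y \<or> \<delta> x y = \<delta> z y"
      using dist_step[of z y x "\<delta> x z"] K xy by auto
    then show ?case using step generate_gen_mult(1)[OF K] by auto
  qed
next
  assume "\<delta> x y \<in> generate W K"
  then obtain ws where "ws \<in> lists K" "\<delta> x y = word_prod W ws"
    using generate_word[OF K] by metis
  then show "gallery C \<delta> K x y"
    using xy(1)
  proof (induction ws arbitrary: x rule: list.induct)
    case Nil
    then show ?case using dist_one_iff[of x y] xy(2) by (simp add: gallery_def)
  next
    case (Cons k ws)
    then have k: "k \<in> K" "k \<in> S" and ws: "ws \<in> lists K" using K by auto
    then have "word_prod W ws \<in> carrier W" using K word_prod_closed lists_mono by blast
    \<comment> \<open>Moving along the first letter \<open>k\<close> strips it from the distance, so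
      the tail \<open>ws\<close> describes the rest of the gallery.\<close>
    moreover obtain z where z: "z \<in> C" "\<delta> z x = k" "\<delta> z y = k \<otimes> \<delta> x y"
      using dist_ex[OF Cons.prems(3) xy(2) k(2)] by auto
    ultimately have "\<delta> z y = word_prod W ws"
      using Cons.prems(2) gen_cancel[OF k(2)] by simp
    then have "gallery C \<delta> K z y" using Cons.IH[OF ws] z(1) by auto
    moreover have "gallery C \<delta> K x z"
      using gallery_step[of z x] gallery_sym[OF K] z k Cons.prems(3) by auto
    ultimately show ?case using gallery_trans by blast
  qed
qed

end

section \<open>Residues and codistance in a twin building\<close>

context twin_building
begin

lemma sign_unique: "x \<in> half \<Delta> \<epsilon> \<Longrightarrow> x \<in> half \<Delta> \<epsilon>' \<Longrightarrow> \<epsilon> = \<epsilon>'"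
  using halves_disjoint by (cases \<epsilon>; cases \<epsilon>') auto

lemma half_chambers: "x \<in> half \<Delta> \<epsilon> \<Longrightarrow> x \<in> chambers \<Delta>"
  unfolding chambers_def by (cases \<epsilon>) auto

lemma adjacent_iff: "x \<in> half \<Delta> \<epsilon> \<Longrightarrow>
    adjacent S \<Delta> x y \<longleftrightarrow> y \<in> half \<Delta> \<epsilon> \<and> dist \<Delta> \<epsilon> x y \<in> S"
  unfolding adjacent_def using sign_unique by metis

definition residue :: "sign \<Rightarrow> 'a set \<Rightarrow> 'c \<Rightarrow> 'c set" where
  "residue \<epsilon> K x = {y. gallery (half \<Delta> \<epsilon>) (dist \<Delta> \<epsilon>) K x y}"

lemma is_residue_iff:
  assumes "K \<subseteq> S"
  shows "is_residue W \<Delta> \<epsilon> K R \<longleftrightarrow> (\<exists>x \<in> half \<Delta> \<epsilon>. R = residue \<epsilon> K x)"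
proof -
  interpret building W S "half \<Delta> \<epsilon>" "dist \<Delta> \<epsilon>" by (rule half_building)
  have "{y \<in> half \<Delta> \<epsilon>. dist \<Delta> \<epsilon> x y \<in> generate W K} = residue \<epsilon> K x" if "x \<in> half \<Delta> \<epsilon>" for x
    unfolding residue_def using dist_generate_iff_gallery[OF assms that] gallery_carrier that by blast
  then show ?thesis unfolding is_residue_def by auto
qed

lemma residue_self: "x \<in> residue \<epsilon> K x"
  unfolding residue_def gallery_def by auto

lemma residue_subset: "x \<in> half \<Delta> \<epsilon> \<Longrightarrow> residue \<epsilon> K x \<subseteq> half \<Delta> \<epsilon>"
  unfolding residue_def using building.gallery_carrier[OF half_building] by fast

lemma residue_eq:
  assumes "K \<subseteq> S" "y \<in> residue \<epsilon> K x"
  shows "residue \<epsilon> K x = residue \<epsilon> K y"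
  using assms building.gallery_sym[OF half_building] building.gallery_trans[OF half_building]
  unfolding residue_def by blast

lemma residue_mono:
  assumes "K \<subseteq> L"
  shows "residue \<epsilon> K x \<subseteq> residue \<epsilon> L x"
  unfolding residue_def gallery_def
  using assms by (auto elim!: rtranclp_mono[THEN predicate2D, rotated])

lemma residue_step:
  assumes "y \<in> residue \<epsilon> K x" "y \<in> half \<Delta> \<epsilon>" "z \<in> half \<Delta> \<epsilon>" "dist \<Delta> \<epsilon> y z \<in> K"
  shows "z \<in> residue \<epsilon> K x"
  using assms unfolding residue_def gallery_def
  by (auto elim: rtranclp.rtrancl_into_rtrancl)

lemma residue_gen_dist:
  assumes "K \<subseteq> S" "x \<in> half \<Delta> \<epsilon>" "y \<in> residue \<epsilon> K x" "dist \<Delta> \<epsilon> x y \<in> S"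
  shows "dist \<Delta> \<epsilon> x y \<in> K"
  using building.dist_generate_iff_gallery[OF half_building assms(1,2), of y] assms
    residue_subset[of x \<epsilon> K] gen_in_generate[OF assms(1,4)]
  unfolding residue_def by auto

text \<open>The axiom determines the codistance only when the length drops. If it rises, some
  \<open>z\<close> in the panel has codistance \<open>s \<otimes> codist \<Delta> x y\<close>; seen
  from \<open>z\<close> the length drops, so every other chamber of the panel has the codistance of
  \<open>x\<close>.\<close>

lemma codist_step:
  assumes "\<epsilon> \<noteq> \<epsilon>'" "x \<in> half \<Delta> \<epsilon>" "x' \<in> half \<Delta> \<epsilon>" "y \<in> half \<Delta> \<epsilon>'" "s \<in> S" "dist \<Delta> \<epsilon> x x' = s"
  shows "codist \<Delta> x' y = codist \<Delta> x y \<or> codist \<Delta> x' y = s \<otimes> codist \<Delta> x y"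
proof -
  interpret building W S "half \<Delta> \<epsilon>" "dist \<Delta> \<epsilon>" by (rule half_building)
  let ?w = "codist \<Delta> x y"
  have w: "?w \<in> carrier W" using codist_carrier assms by auto
  have x': "dist \<Delta> \<epsilon> x' x = s" using dist_gen_sym assms by metis
  consider "coxeter_length W S (s \<otimes> ?w) < coxeter_length W S ?w"
    | "coxeter_length W S ?w < coxeter_length W S (s \<otimes> ?w)"
    using coxeter_length_gen_mult[OF assms(5) w] by linarith
  then show ?thesis
  proof cases
    case 1
    then show ?thesis using codist_step_down[OF assms(1,2,4,3,5) x'] by simp
  next
    case 2
    obtain z where z: "z \<in> half \<Delta> \<epsilon>" "dist \<Delta> \<epsilon> z x = s" "codist \<Delta> z y = s \<otimes> ?w"
      using codist_ex[OF assms(1,2,4,5)] by auto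
    have xz: "dist \<Delta> \<epsilon> x z = s" using dist_gen_sym z assms by metis
    show ?thesis
    proof (cases "x' = z")
      case False
      then have "dist \<Delta> \<epsilon> x' z = s" using panel_trans assms z(1) xz by metis
      then have "codist \<Delta> x' y = s \<otimes> codist \<Delta> z y"
        using codist_step_down[OF assms(1) z(1) assms(4,3,5)] z(3) 2 gen_cancel[OF assms(5) w] by auto
      then show ?thesis using z(3) gen_cancel[OF assms(5) w] by simp
    qed (use z in auto)
  qed
qed

lemma codist_step_right:
  assumes "\<epsilon> \<noteq> \<epsilon>'" "x \<in> half \<Delta> \<epsilon>" "y \<in> half \<Delta> \<epsilon>'" "y' \<in> half \<Delta> \<epsilon>'" "s \<in> S" "dist \<Delta> \<epsilon>' y y' = s"
  shows "codist \<Delta> x y' = codist \<Delta> x y \<or> codist \<Delta> x y' = codist \<Delta> x y \<otimes> s"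
proof -
  have c: "codist \<Delta> y x \<in> carrier W" using codist_carrier assms by metis
  have "codist \<Delta> y' x = codist \<Delta> y x \<or> codist \<Delta> y' x = s \<otimes> codist \<Delta> y x"
    using codist_step[of \<epsilon>' \<epsilon> y y' x s] assms by auto
  then show ?thesis
    using codist_inv[OF assms(1,2,3)] codist_inv[OF assms(1,2,4)] c assms(5)
    by (auto simp: inv_mult_group gen_closed gen_inv)
qed

text \<open>Each step of a gallery of type \<open>L\<close> either keeps the codistance or
  multiplies it on the right by an element of \<open>L\<close>.\<close>

lemma codist_residue:
  assumes "\<epsilon> \<noteq> \<epsilon>'" "x \<in> half \<Delta> \<epsilon>" "y \<in> half \<Delta> \<epsilon>'" "L \<subseteq> S" "y' \<in> residue \<epsilon>' L y"
    "codist \<Delta> x y \<in> generate W L"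
  shows "codist \<Delta> x y' \<in> generate W L"
  using assms(5) unfolding residue_def gallery_def mem_Collect_eq
proof (induction rule: rtranclp_induct)
  case (step y z)
  then have "codist \<Delta> x z = codist \<Delta> x y \<or> codist \<Delta> x z = codist \<Delta> x y \<otimes> dist \<Delta> \<epsilon>' y z"
    using codist_step_right[OF assms(1,2), of y z "dist \<Delta> \<epsilon>' y z"] assms(4) by blast
  then show ?case
    using step generate_gen_mult(2)[OF assms(4)] by metis
qed (rule assms(6))

end


section \<open>Opposite automorphisms\<close>

locale opposite_automorphism = twin_building W S \<Delta>
  for W (structure) and S and \<Delta> :: "('c, 'a) twin" +
  fixes J :: "'a set" and \<theta> :: "'c \<Rightarrow> 'c"
  assumes finite_S: "finite S" and J_subset: "J \<subseteq> S"
    and automorphism: "twin_automorphism W S \<Delta> \<theta>"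
    and J_opp: "J_opposite W S \<Delta> J \<theta>"
begin

section \<open>Action of the automorphism on chambers and panels\<close>

lemma theta_bij: "bij_betw \<theta> (chambers \<Delta>) (chambers \<Delta>)"
  using automorphism unfolding twin_automorphism_def by auto

lemma theta_inj:
  assumes "x \<in> half \<Delta> \<epsilon>" "y \<in> half \<Delta> \<epsilon>" "\<theta> x = \<theta> y"
  shows "x = y"
  using theta_bij assms half_chambers unfolding bij_betw_def inj_on_def by blast

lemma theta_adjacent:
  assumes "x \<in> half \<Delta> \<epsilon>" "\<theta> x \<in> half \<Delta> \<epsilon>'" "y \<in> half \<Delta> \<epsilon>"
  shows "\<theta> y \<in> half \<Delta> \<epsilon>' \<and> dist \<Delta> \<epsilon>' (\<theta> x) (\<theta> y) \<in> S \<longleftrightarrow> dist \<Delta> \<epsilon> x y \<in> S"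
  using automorphism half_chambers assms adjacent_iff[OF assms(1)] adjacent_iff[OF assms(2)]
  unfolding twin_automorphism_def by metis

lemma theta_adjacent_preimage:
  assumes "x \<in> half \<Delta> \<epsilon>" "\<theta> x \<in> half \<Delta> \<epsilon>'" "z \<in> half \<Delta> \<epsilon>'" "dist \<Delta> \<epsilon>' (\<theta> x) z \<in> S"
  obtains y where "y \<in> half \<Delta> \<epsilon>" "z = \<theta> y" "dist \<Delta> \<epsilon> x y \<in> S"
proof -
  obtain y where y: "y \<in> chambers \<Delta>" "z = \<theta> y"
    using theta_bij half_chambers[OF assms(3)] unfolding bij_betw_def by auto
  have "adjacent S \<Delta> (\<theta> x) (\<theta> y)" using assms y adjacent_iff[OF assms(2)] by auto
  then have "adjacent S \<Delta> x y"
    using automorphism half_chambers[OF assms(1)] y unfolding twin_automorphism_def by auto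
  then show ?thesis using that y adjacent_iff[OF assms(1)] by auto
qed

text \<open>Triangles in the chamber graph lie in panels, so \<open>\<theta>\<close> maps panels into panels.\<close>

lemma theta_panel:
  assumes "x \<in> half \<Delta> \<epsilon>" "\<theta> x \<in> half \<Delta> \<epsilon>'" "y \<in> half \<Delta> \<epsilon>" "z \<in> half \<Delta> \<epsilon>"
    "dist \<Delta> \<epsilon> x y \<in> S" "dist \<Delta> \<epsilon> x z \<in> S"
  shows "dist \<Delta> \<epsilon>' (\<theta> x) (\<theta> y) = dist \<Delta> \<epsilon>' (\<theta> x) (\<theta> z) \<longleftrightarrow> dist \<Delta> \<epsilon> x y = dist \<Delta> \<epsilon> x z"
proof -
  have *: "\<theta> y \<in> half \<Delta> \<epsilon>'" "dist \<Delta> \<epsilon>' (\<theta> x) (\<theta> y) \<in> S"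
     "\<theta> z \<in> half \<Delta> \<epsilon>'" "dist \<Delta> \<epsilon>' (\<theta> x) (\<theta> z) \<in> S"
    using theta_adjacent[OF assms(1,2)] assms by auto
  have **: "\<theta> z \<in> half \<Delta> \<epsilon>' \<and> dist \<Delta> \<epsilon>' (\<theta> y) (\<theta> z) \<in> S \<longleftrightarrow> dist \<Delta> \<epsilon> y z \<in> S"
    using theta_adjacent[OF assms(3) *(1) assms(4)] .
  interpret A: building W S "half \<Delta> \<epsilon>" "dist \<Delta> \<epsilon>" by (rule half_building)
  interpret B: building W S "half \<Delta> \<epsilon>'" "dist \<Delta> \<epsilon>'" by (rule half_building)
  \<comment> \<open>Two neighbours of \<open>x\<close> have the same type exactly when they are
    equal or adjacent, a condition that \<open>\<theta>\<close> preserves.\<close>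
  have "dist \<Delta> \<epsilon> x y = dist \<Delta> \<epsilon> x z \<longleftrightarrow> y = z \<or> dist \<Delta> \<epsilon> y z \<in> S"
    using A.panel_trans[of x y z] A.triangle_types_eq[of x y z] assms by metis
  moreover have "dist \<Delta> \<epsilon>' (\<theta> x) (\<theta> y) = dist \<Delta> \<epsilon>' (\<theta> x) (\<theta> z) \<longleftrightarrow>
      \<theta> y = \<theta> z \<or> dist \<Delta> \<epsilon>' (\<theta> y) (\<theta> z) \<in> S"
    using B.panel_trans[of "\<theta> x" "\<theta> y" "\<theta> z"] B.triangle_types_eq[of "\<theta> x" "\<theta> y" "\<theta> z"] assms(2) *
    by metis
  ultimately show ?thesis using ** *(3) theta_inj[OF assms(3,4)] by auto
qed

text \<open>Opposition only yields that the type \<open>L\<close> of the image of a residue of type \<open>S - J\<close>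
  contains \<open>S - J\<close>; equality comes from counting panels at a chamber.\<close>

lemma codist_theta:
  assumes x: "x \<in> half \<Delta> \<epsilon>"
  obtains \<epsilon>' where "\<epsilon> \<noteq> \<epsilon>'" "\<theta> x \<in> half \<Delta> \<epsilon>'" "codist \<Delta> x (\<theta> x) \<in> generate W (S - J)"
proof -
  define K where "K = S - J"
  define P where "P = residue \<epsilon> K x"
  have K: "K \<subseteq> S" unfolding K_def by auto
  have xP: "x \<in> P" unfolding P_def by (rule residue_self)
  have P_half: "P \<subseteq> half \<Delta> \<epsilon>" unfolding P_def using residue_subset[OF x] .
  have "is_residue W \<Delta> \<epsilon> K P" unfolding is_residue_iff[OF K] P_def using x by auto
  then have "opposite_residues W S \<Delta> P (\<theta> ` P)"
    using J_opp unfolding J_opposite_def K_def by auto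
  then obtain \<epsilon>1 \<epsilon>' K1 L where r: "\<epsilon>1 \<noteq> \<epsilon>'" "K1 \<subseteq> S" "L \<subseteq> S" "is_residue W \<Delta> \<epsilon>1 K1 P"
      "is_residue W \<Delta> \<epsilon>' L (\<theta> ` P)"
    and opp: "\<And>p. p \<in> P \<Longrightarrow> \<exists>q \<in> \<theta> ` P. opposite W \<Delta> p q"
    unfolding opposite_residues_def by blast
  have "x \<in> half \<Delta> \<epsilon>1" using r(4) xP unfolding is_residue_def by auto
  then have ne: "\<epsilon> \<noteq> \<epsilon>'" using sign_unique x r(1) by auto
  obtain z where z: "z \<in> half \<Delta> \<epsilon>'" "\<theta> ` P = residue \<epsilon>' L z"
    using r(5) unfolding is_residue_iff[OF r(3)] by auto
  have Q_half: "\<theta> ` P \<subseteq> half \<Delta> \<epsilon>'" unfolding z(2) by (rule residue_subset[OF z(1)])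
  have Q: "\<theta> ` P = residue \<epsilon>' L q" if "q \<in> \<theta> ` P" for q
    using residue_eq[OF r(3)] that unfolding z(2) .
  have tx: "\<theta> x \<in> half \<Delta> \<epsilon>'" using Q_half xP by auto
  have opp': "\<exists>q \<in> \<theta> ` P. codist \<Delta> p q = \<one>" if "p \<in> P" for p
    using opp[OF that] unfolding opposite_def by auto
  obtain q where q: "q \<in> \<theta> ` P" "codist \<Delta> x q = \<one>" using opp'[OF xP] by auto
  have q_half: "q \<in> half \<Delta> \<epsilon>'" using q Q_half by auto
  interpret A: building W S "half \<Delta> \<epsilon>" "dist \<Delta> \<epsilon>" by (rule half_building)
  interpret B: building W S "half \<Delta> \<epsilon>'" "dist \<Delta> \<epsilon>'" by (rule half_building)
  \<comment> \<open>Move from \<open>x\<close> to a \<open>k\<close>-neighbour \<open>y\<close> with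
    \<open>codist \<Delta> y q = k\<close>. Some \<open>q'\<close> in the image is opposite
    \<open>y\<close>, and \<open>q\<close>, \<open>q'\<close> share a residue of type
    \<open>L\<close>; so \<open>k\<close> lies in the parabolic subgroup of
    \<open>L\<close>.\<close>
  have "K \<subseteq> L"
  proof
    fix k assume k: "k \<in> K"
    then have kS: "k \<in> S" using K by auto
    obtain y where y: "y \<in> half \<Delta> \<epsilon>" "dist \<Delta> \<epsilon> y x = k" "codist \<Delta> y q = k"
      using codist_ex[OF ne x q_half kS] q(2) gen_closed[OF kS] by auto
    have "dist \<Delta> \<epsilon> x y = k" using A.dist_gen_sym y kS x by metis
    then have "y \<in> P" using residue_step[of x \<epsilon> K x y] xP x y k unfolding P_def by auto
    then obtain q' where q': "q' \<in> \<theta> ` P" "codist \<Delta> y q' = \<one>" using opp' by auto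
    have "q' \<in> half \<Delta> \<epsilon>'" "q \<in> residue \<epsilon>' L q'" using q'(1) q(1) Q Q_half by blast+
    then have "codist \<Delta> y q \<in> generate W L"
      using codist_residue[OF ne y(1) _ r(3)] q'(2) generate.one by metis
    then show "k \<in> L" using gen_in_generate[OF r(3) kS] y(3) by simp
  qed
  moreover have "card L \<le> card K"
  proof (rule surj_card_le)
    show "finite K" using finite_S K finite_subset by auto
    define \<sigma> where "\<sigma> t = dist \<Delta> \<epsilon>' (\<theta> x) (\<theta> (SOME y. y \<in> half \<Delta> \<epsilon> \<and> dist \<Delta> \<epsilon> x y = t))" for t
    show "L \<subseteq> \<sigma> ` K"
    proof
      fix u assume u: "u \<in> L"
      then have uS: "u \<in> S" using r(3) by auto
      obtain v where v: "v \<in> half \<Delta> \<epsilon>'" "dist \<Delta> \<epsilon>' (\<theta> x) v = u"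
        using B.dist_ex[OF tx tx uS] B.dist_gen_sym uS tx by metis
      have "v \<in> residue \<epsilon>' L (\<theta> x)" using residue_step[OF residue_self tx v(1)] v u by auto
      then have "v \<in> \<theta> ` P" using Q xP by auto
      then obtain y where y: "y \<in> P" "v = \<theta> y" by auto
      have yh: "y \<in> half \<Delta> \<epsilon>" using y P_half by auto
      have yS: "dist \<Delta> \<epsilon> x y \<in> S" using theta_adjacent[OF x tx yh] v y uS by auto
      then have yK: "dist \<Delta> \<epsilon> x y \<in> K" using residue_gen_dist[OF K x] y unfolding P_def by auto
      let ?y = "SOME y'. y' \<in> half \<Delta> \<epsilon> \<and> dist \<Delta> \<epsilon> x y' = dist \<Delta> \<epsilon> x y"
      have "?y \<in> half \<Delta> \<epsilon> \<and> dist \<Delta> \<epsilon> x ?y = dist \<Delta> \<epsilon> x y"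
        by (rule someI[of _ y]) (use yh in auto)
      then have "\<sigma> (dist \<Delta> \<epsilon> x y) = u"
        unfolding \<sigma>_def using theta_panel[OF x tx, of ?y y] yh yS v y by auto
      then show "u \<in> \<sigma> ` K" using yK by auto
    qed
  qed
  ultimately have "L = K"
    using card_seteq[of L K] finite_S r(3) finite_subset by auto
  \<comment> \<open>Both \<open>\<theta> x\<close> and the chamber \<open>q\<close> opposite
    \<open>x\<close> lie in the same residue of type \<open>L\<close>.\<close>
  moreover have "codist \<Delta> x (\<theta> x) \<in> generate W L"
    using codist_residue[OF ne x q_half r(3), of "\<theta> x"] Q[OF q(1)] xP q(2) generate.one by auto
  ultimately show ?thesis using that ne tx unfolding K_def by auto
qed

text \<open>With \<open>w = codist x (\<theta> x)\<close> and \<open>u\<close> the type of the image of the \<open>s\<close>-panel at \<open>x\<close>, a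
  chamber \<open>y\<close> of this panel with \<open>codist y (\<theta> x) = s w\<close> has \<open>codist y (\<theta> y) \<in> {s w, s w u}\<close>.
  As this lies in the parabolic subgroup of \<open>S - J\<close>, it must be \<open>s w u\<close>, and \<open>u = s\<close>.\<close>

lemma theta_preserves_J_type:
  assumes s: "s \<in> J" and x: "x \<in> half \<Delta> \<epsilon>" "\<theta> x \<in> half \<Delta> \<epsilon>'"
    and y: "y \<in> half \<Delta> \<epsilon>" "dist \<Delta> \<epsilon> x y \<in> S"
  shows "dist \<Delta> \<epsilon>' (\<theta> x) (\<theta> y) = s \<longleftrightarrow> dist \<Delta> \<epsilon> x y = s"
proof -
  interpret A: building W S "half \<Delta> \<epsilon>" "dist \<Delta> \<epsilon>" by (rule half_building)
  have sS: "s \<in> S" using s J_subset by auto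
  let ?K = "S - J" and ?w = "codist \<Delta> x (\<theta> x)"
  have ne: "\<epsilon> \<noteq> \<epsilon>'" and w: "?w \<in> generate W ?K"
    using codist_theta[OF x(1)] sign_unique[OF x(2)] by metis+
  have wc: "?w \<in> carrier W" using codist_carrier ne x by auto
  obtain z where z: "z \<in> half \<Delta> \<epsilon>" "dist \<Delta> \<epsilon> z x = s" "codist \<Delta> z (\<theta> x) = s \<otimes> ?w"
    using codist_ex[OF ne x sS] by auto
  have xz: "dist \<Delta> \<epsilon> x z = s" using A.dist_gen_sym z sS x by metis
  define u where "u = dist \<Delta> \<epsilon>' (\<theta> x) (\<theta> z)"
  have tz: "\<theta> z \<in> half \<Delta> \<epsilon>'" and uS: "u \<in> S"
    using theta_adjacent[OF x z(1)] xz sS unfolding u_def by auto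
  have zK: "codist \<Delta> z (\<theta> z) \<in> generate W ?K" using codist_theta[OF z(1)] by metis
  have "codist \<Delta> z (\<theta> z) = s \<otimes> ?w \<or> codist \<Delta> z (\<theta> z) = s \<otimes> ?w \<otimes> u"
    using codist_step_right[OF ne z(1) x(2) tz uS] u_def z(3) by auto
  \<comment> \<open>Adjoining \<open>u\<close> to \<open>S - J\<close> treats both alternatives
    alike. Cancelling \<open>?w\<close> then puts \<open>s\<close> itself into the enlarged
    parabolic subgroup, and \<open>s\<close> is not in \<open>S - J\<close>.\<close>
  then have "s \<otimes> ?w \<in> generate W (insert u ?K)"
  proof
    assume "codist \<Delta> z (\<theta> z) = s \<otimes> ?w"
    then show ?thesis using zK mono_generate[of ?K "insert u ?K"] by auto
  next
    assume "codist \<Delta> z (\<theta> z) = s \<otimes> ?w \<otimes> u"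
    then have "s \<otimes> ?w = codist \<Delta> z (\<theta> z) \<otimes> u"
      using sS uS wc by (simp add: m_assoc gen_closed gen_square)
    moreover have "codist \<Delta> z (\<theta> z) \<in> generate W (insert u ?K)"
      using zK mono_generate[of ?K "insert u ?K"] by auto
    ultimately show ?thesis using generate_gen_mult(2)[of "insert u ?K" u] uS by auto
  qed
  moreover have "inv ?w \<in> generate W (insert u ?K)"
    using w generate_m_inv_closed[of ?K ?w] S_carrier mono_generate[of ?K "insert u ?K"] by auto
  ultimately have "s \<otimes> ?w \<otimes> inv ?w \<in> generate W (insert u ?K)"
    by (rule generate.eng)
  then have "s \<in> generate W (insert u ?K)"
    using wc sS by (simp add: m_assoc gen_closed)
  then have "u = s" using gen_in_generate[of "insert u ?K" s] uS sS s by auto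
  \<comment> \<open>The panel of \<open>z\<close> has type \<open>s\<close> and image type
    \<open>s\<close>; an arbitrary neighbour \<open>y\<close> is compared with
    \<open>z\<close>.\<close>
  then show ?thesis
    using theta_panel[OF x y(1) z(1) y(2)] xz sS u_def by auto
qed

lemma theta_residue:
  assumes s: "s \<in> J" and x: "x \<in> half \<Delta> \<epsilon>" "\<theta> x \<in> half \<Delta> \<epsilon>'"
  shows "\<theta> ` residue \<epsilon> (S - {s}) x = residue \<epsilon>' (S - {s}) (\<theta> x)"
proof
  have "\<theta> y \<in> half \<Delta> \<epsilon>' \<and> \<theta> y \<in> residue \<epsilon>' (S - {s}) (\<theta> x)"
    if "y \<in> residue \<epsilon> (S - {s}) x" for y
    using that unfolding residue_def[of \<epsilon>] gallery_def mem_Collect_eq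
  proof (induction rule: rtranclp_induct)
    case base
    then show ?case using x residue_self by auto
  next
    case (step y z)
    then have "\<theta> z \<in> half \<Delta> \<epsilon>'" "dist \<Delta> \<epsilon>' (\<theta> y) (\<theta> z) \<in> S - {s}"
      using theta_adjacent[of y \<epsilon> \<epsilon>' z] theta_preserves_J_type[OF s, of y \<epsilon> \<epsilon>' z] by auto
    then show ?case using residue_step step.IH by blast
  qed
  then show "\<theta> ` residue \<epsilon> (S - {s}) x \<subseteq> residue \<epsilon>' (S - {s}) (\<theta> x)" by auto
next
  have "v \<in> \<theta> ` residue \<epsilon> (S - {s}) x" if "v \<in> residue \<epsilon>' (S - {s}) (\<theta> x)" for v
    using that unfolding residue_def[of \<epsilon>'] gallery_def mem_Collect_eq
  proof (induction rule: rtranclp_induct)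
    case base
    then show ?case using residue_self by auto
  next
    case (step v v')
    then obtain y where y: "y \<in> residue \<epsilon> (S - {s}) x" "v = \<theta> y" by auto
    have yh: "y \<in> half \<Delta> \<epsilon>" using y residue_subset[OF x(1)] by auto
    obtain y' where y': "y' \<in> half \<Delta> \<epsilon>" "v' = \<theta> y'" "dist \<Delta> \<epsilon> y y' \<in> S"
      using theta_adjacent_preimage[OF yh, of \<epsilon>' v'] step y by auto
    have "dist \<Delta> \<epsilon> y y' \<noteq> s"
      using theta_preserves_J_type[OF s yh _ y'(1,3), of \<epsilon>'] step y y' by auto
    then have "y' \<in> residue \<epsilon> (S - {s}) x" using residue_step[OF y(1) yh y'(1)] y' by auto
    then show ?case using y' by auto
  qed
  then show "residue \<epsilon>' (S - {s}) (\<theta> x) \<subseteq> \<theta> ` residue \<epsilon> (S - {s}) x" by auto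
qed

lemma singleton_opposite:
  assumes s: "s \<in> J"
  shows "J_opposite W S \<Delta> {s} \<theta>"
  unfolding J_opposite_def
proof (intro allI impI)
  fix \<epsilon> R assume R: "is_residue W \<Delta> \<epsilon> (S - {s}) R"
  have K: "S - {s} \<subseteq> S" "S - J \<subseteq> S" by auto
  obtain x where x: "x \<in> half \<Delta> \<epsilon>" "R = residue \<epsilon> (S - {s}) x"
    using R unfolding is_residue_iff[OF K(1)] by auto
  obtain \<epsilon>' where e: "\<epsilon> \<noteq> \<epsilon>'" "\<theta> x \<in> half \<Delta> \<epsilon>'" using codist_theta[OF x(1)] by metis
  have "is_residue W \<Delta> \<epsilon>' (S - {s}) (\<theta> ` R)"
    unfolding is_residue_iff[OF K(1)] using theta_residue[OF s x(1) e(2)] x(2) e(2) by auto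
  moreover have "\<exists>q \<in> \<theta> ` R. opposite W \<Delta> p q" if p: "p \<in> R" for p
  proof -
    have ph: "p \<in> half \<Delta> \<epsilon>" using p x residue_subset by auto
    let ?P = "residue \<epsilon> (S - J) p"
    have "is_residue W \<Delta> \<epsilon> (S - J) ?P" unfolding is_residue_iff[OF K(2)] using ph by auto
    then have "opposite_residues W S \<Delta> ?P (\<theta> ` ?P)"
      using J_opp unfolding J_opposite_def by simp
    then have "\<exists>q \<in> \<theta> ` ?P. opposite W \<Delta> p q"
      using residue_self[of p] unfolding opposite_residues_def by simp
    moreover have "?P \<subseteq> R"
      using residue_mono[of "S - J" "S - {s}" \<epsilon> p] residue_eq[OF K(1)] p s unfolding x(2) by auto
    ultimately show ?thesis by auto
  qed
  ultimately show "opposite_residues W S \<Delta> R (\<theta> ` R)"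
    unfolding opposite_residues_def using e(1) K(1) R by blast
qed

end

theorem lemma4p1:
  fixes W :: "('w, 'b) monoid_scheme" and S J :: "'w set"
    and \<Delta> :: "('c, 'w) twin" and \<theta> :: "'c \<Rightarrow> 'c"
  assumes "coxeter_system W S" and "finite S" and "coxeter_irreducible W S"
    and "twin_building W S \<Delta>"
    and "J \<subseteq> S" and "J \<noteq> {}"
    and "twin_automorphism W S \<Delta> \<theta>"
    and "J_opposite W S \<Delta> J \<theta>"
  shows "\<forall>s \<in> J. J_opposite W S \<Delta> {s} \<theta>"
proof -
  interpret opposite_automorphism W S \<Delta> J \<theta>
    using assms by (auto simp: opposite_automorphism_def opposite_automorphism_axioms_def)
  show ?thesis using singleton_opposite by blast
qed

end
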